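(* Let $G$ be a graph. Every maximum matching in $G$ is acyclic if and only if every component of $G$ is a tree or an odd cycle.
   Context: All graphs are finite, simple, and undirected. A matching in a graph $G$ is a set of pairwise disjoint edges of $G$; a maximum matching is a matching of largest size. For a matching $M$ in $G$, let $V(M)$ be the set of vertices of $G$ incident with an edge in $M$, and let $G(M)$ be the subgraph of $G$ induced by $V(M)$. The matching $M$ is acyclic if $G(M)$ is a forest. That a component is an odd cycle means that the component, as a graph, is a cycle of odd length. *)

theory Defs
  imports "Graph_Theory.Graph_Theory"
begin

text \<open>
  A finite simple undirected graph is represented as in the library, by the locale predicate
  \<^term>\<open>Digraph.graph\<close>: a finite loop-free digraph without parallel arcs whose arc relation is
  symmetric. An undirected edge is the set of the two endpoints of an arc; it corresponds to
  exactly one pair of opposite arcs.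
\<close>

definition endpoints :: "('a, 'b) pre_digraph \<Rightarrow> 'b \<Rightarrow> 'a set" where
  "endpoints G e = {tail G e, head G e}"

definition edges :: "('a, 'b) pre_digraph \<Rightarrow> 'a set set" where
  "edges G = endpoints G ` arcs G"

definition matching :: "('a, 'b) pre_digraph \<Rightarrow> 'a set set \<Rightarrow> bool" where
  "matching G M \<longleftrightarrow> M \<subseteq> edges G \<and> pairwise disjnt M"

definition maximum_matching :: "('a, 'b) pre_digraph \<Rightarrow> 'a set set \<Rightarrow> bool" where
  "maximum_matching G M \<longleftrightarrow> matching G M \<and> (\<forall>N. matching G N \<longrightarrow> card N \<le> card M)"

text \<open>
  The library's \<^term>\<open>pre_digraph.cycle\<close> is directed, so it also accepts the walk of length two
  along an arc and back along its opposite. In the absence of loops and parallel arcs, the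
  undirected cycles are exactly those of length at least three. For the same reason the library's
  \<^term>\<open>Digraph_Component.forest\<close> and \<^term>\<open>Digraph_Component.tree\<close> are not the undirected
  notions.
\<close>

definition undirected_cycle :: "('a, 'b) pre_digraph \<Rightarrow> 'b awalk \<Rightarrow> bool" where
  "undirected_cycle G p \<longleftrightarrow> pre_digraph.cycle G p \<and> 3 \<le> length p"

definition undirected_forest :: "('a, 'b) pre_digraph \<Rightarrow> bool" where
  "undirected_forest G \<longleftrightarrow> \<not> (\<exists>p. undirected_cycle G p)"

definition undirected_tree :: "('a, 'b) pre_digraph \<Rightarrow> bool" where
  "undirected_tree G \<longleftrightarrow> connected G \<and> undirected_forest G"

definition odd_cycle_graph :: "('a, 'b) pre_digraph \<Rightarrow> bool" where
  "odd_cycle_graph G \<longleftrightarrow>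
    (\<exists>p. undirected_cycle G p \<and> odd (length p) \<and>
      verts G = tail G ` set p \<and> edges G = endpoints G ` set p)"

definition acyclic_matching :: "('a, 'b) pre_digraph \<Rightarrow> 'a set set \<Rightarrow> bool" where
  "acyclic_matching G M \<longleftrightarrow> matching G M \<and> undirected_forest (G \<restriction> \<Union>M)"

text \<open>
  The library's \<^term>\<open>Digraph_Component.connected\<close> requires a vertex, so the empty graph has no
  components. Subgraphs are sub-digraphs, but by maximality a component contains every arc of the
  graph between its vertices, hence is itself symmetric.
\<close>

definition component :: "('a, 'b) pre_digraph \<Rightarrow> ('a, 'b) pre_digraph \<Rightarrow> bool" where
  "component G H \<longleftrightarrow> pre_digraph.max_subgraph G connected H"

end

theory Submission
  imports Defs
begin

text \<open>
  Every matching \<open>N\<close> is covered by some maximum matching, so it suffices to study cycles whose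
  vertices can be matched. An even cycle has a perfect matching. An odd cycle in a component that
  is not just this cycle has either a chord, which creates an even cycle, or a neighbour outside,
  which can be matched with a cycle vertex so that an even path remains. Conversely, a cycle inside
  \<open>G(M)\<close> that lies in an odd cycle component fills the component, whose vertex set
  is then partitioned by the edges of \<open>M\<close>, contradicting odd order.
\<close>

section \<open>Cycles\<close>

text \<open>Replaces the recursion along a walk by one equation between lists, so that facts about
  rotating lists become applicable.\<close>

lemma (in pre_digraph) cas_iff_map: "cas u p v \<longleftrightarrow> map (tail G) p @ [v] = u # map (head G) p"
  by (induct p arbitrary: u) auto

text \<open>A walk closes up when its heads are its tails shifted by one place. This form mentions
  no base point, so it passes easily to rotations and subgraphs.\<close>

lemma (in wf_digraph) cycle_iff_rotate1:
  "cycle p \<longleftrightarrow> p \<noteq> [] \<and> set p \<subseteq> arcs G \<and> distinct (map (tail G) p) \<and>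
    map (head G) p = rotate1 (map (tail G) p)"
proof (cases p)
  case Nil
  then show ?thesis by (simp add: cycle_def)
next
  case (Cons a r)
  have cas: "cas u p u \<longleftrightarrow> u = tail G a \<and> map (head G) p = rotate1 (map (tail G) p)" for u
    unfolding cas_iff_map using Cons by auto
  \<comment> \<open>Without its first entry, \<open>awalk_verts u p\<close> is the list of heads, a
    rotation of the list of tails.\<close>
  have "distinct (tl (awalk_verts u p)) \<longleftrightarrow> distinct (map (tail G) p)" if "cas u p u" for u
    using that Cons cas[of u] awalk_verts_conv'[OF that]
    by (metis distinct1_rotate list.sel(3) list.simps(3))
  then show ?thesis
    using Cons cas unfolding cycle_def awalk_def by auto
qed

lemma (in wf_digraph) undirected_cycle_iff:
  "undirected_cycle G p \<longleftrightarrow> 3 \<le> length p \<and> set p \<subseteq> arcs G \<and> distinct (map (tail G) p) \<and>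
    map (head G) p = rotate1 (map (tail G) p)"
  unfolding undirected_cycle_def cycle_iff_rotate1 by auto

lemma (in wf_digraph) undirected_cycle_subgraph:
  assumes "subgraph H G" "undirected_cycle H p"
  shows "undirected_cycle G p"
  using assms subgraph_cycle unfolding undirected_cycle_def by blast

text \<open>Bounding the tails suffices, because the heads of a cycle are the same vertices.\<close>

lemma (in wf_digraph) undirected_cycle_induce:
  assumes "undirected_cycle G p" "tail G ` set p \<subseteq> S"
  shows "undirected_cycle (G \<restriction> S) p"
proof -
  interpret S: wf_digraph "G \<restriction> S" ..
  have "head G ` set p = tail G ` set p"
    using assms(1) unfolding undirected_cycle_iff by (metis list.set_map set_rotate1)
  then show ?thesis
    using assms unfolding undirected_cycle_iff S.undirected_cycle_iff by auto
qed

lemma (in wf_digraph) undirected_cycle_rotate_to: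
  assumes "undirected_cycle G p" "x \<in> tail G ` set p"
  obtains q where "undirected_cycle G q" "set q = set p" "length q = length p" "tail G (hd q) = x"
proof -
  obtain i where i: "i < length p" "tail G (p ! i) = x"
    using assms(2) by (auto simp: in_set_conv_nth)
  have "map (head G) (rotate i p) = rotate1 (map (tail G) (rotate i p))"
    using assms(1) unfolding undirected_cycle_iff by (simp add: rotate_map[symmetric] rotate1_rotate_swap)
  then have "undirected_cycle G (rotate i p)"
    using assms(1) unfolding undirected_cycle_iff by (simp add: rotate_map[symmetric])
  moreover have "tail G (hd (rotate i p)) = x"
    using i by (subst hd_rotate_conv_nth) auto
  ultimately show thesis
    using that[of "rotate i p"] by simp
qed

text \<open>Once the cycle starts at \<open>x\<close>, \<open>e\<close> is its first arc and
  \<open>f\<close> its last. Length at least three puts a second arc \<open>d\<close> strictly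
  between them, and the tails of \<open>d\<close> and \<open>f\<close> differ.\<close>

lemma (in wf_digraph) undirected_cycle_neighbours:
  assumes "undirected_cycle G p" "x \<in> tail G ` set p"
  obtains e f where "e \<in> set p" "f \<in> set p" "tail G e = x" "head G f = x" "head G e \<noteq> tail G f"
proof -
  obtain q where q: "undirected_cycle G q" "set q = set p" "tail G (hd q) = x"
    using undirected_cycle_rotate_to[OF assms] by metis
  have n: "3 \<le> length q" using q(1) by (simp add: undirected_cycle_def)
  obtain e q' where e: "q = e # q'" using n by (cases q) auto
  obtain f r where f: "q' = r @ [f]" using n e by (cases q' rule: rev_cases) auto
  obtain d s where d: "r = d # s" using n e f by (cases r) auto
  have "distinct (map (tail G) q)" "map (head G) q = rotate1 (map (tail G) q)"
    using q(1) by (auto simp: undirected_cycle_iff)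
  then have "head G e = tail G d" "head G f = tail G e" "tail G d \<noteq> tail G f"
    by (auto simp: e f d)
  then show thesis
    using that[of e f] q(2,3) by (auto simp: e f)
qed

text \<open>Forgets the closing edge and reads the cycle as a path, the input of
  \<open>matching_of_even_path\<close>.\<close>

lemma (in wf_digraph) undirected_cycle_successively:
  assumes "undirected_cycle G p"
  shows "successively (\<lambda>u v. {u, v} \<in> edges G) (map (tail G) p)"
  unfolding successively_conv_nth
proof (intro allI impI)
  fix i assume i: "Suc i < length (map (tail G) p)"
  have "map (head G) p ! i = rotate1 (map (tail G) p) ! i"
    using assms by (simp add: undirected_cycle_iff)
  then have "head G (p ! i) = tail G (p ! Suc i)"
    using i by (simp add: nth_rotate1)
  moreover have "p ! i \<in> arcs G"
    using assms i nth_mem[of i p] by (auto simp: undirected_cycle_iff)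
  ultimately show "{map (tail G) p ! i, map (tail G) p ! Suc i} \<in> edges G"
    using i by (auto simp: edges_def endpoints_def intro!: image_eqI[of _ _ "p ! i"])
qed

text \<open>A chord splits an odd cycle into two cycles whose lengths have different parities.\<close>

lemma (in graph) even_cycle_of_chord:
  assumes p: "undirected_cycle G p" and odd: "odd (length p)"
    and a: "a \<in> arcs G" "tail G a \<in> tail G ` set p" "head G a \<in> tail G ` set p"
    and chord: "endpoints G a \<notin> endpoints G ` set p"
  obtains q where "undirected_cycle G q" "even (length q)"
proof -
  obtain p' where p': "undirected_cycle G p'" "set p' = set p" "length p' = length p"
    "tail G (hd p') = tail G a"
    using undirected_cycle_rotate_to[OF p a(2)] by metis
  define us where "us = map (tail G) p'"
  define n where "n = length p'"
  have n: "3 \<le> n" "length us = n" "odd n"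
    using p' odd by (auto simp: n_def us_def undirected_cycle_def)
  have us: "distinct us" "map (head G) p' = rotate1 us" "set p' \<subseteq> arcs G"
    using p' by (auto simp: us_def undirected_cycle_iff)
  have "us \<noteq> []" using n by auto
  have hd: "hd us = tail G a"
    using p'(4) \<open>us \<noteq> []\<close> by (simp add: us_def hd_map)
  then have us0: "us ! 0 = tail G a"
    using \<open>us \<noteq> []\<close> by (simp add: hd_conv_nth)
  have heads: "map (head G) p' = tl us @ [tail G a]"
    using us(2) \<open>us \<noteq> []\<close> hd by (simp add: rotate1_hd_tl)
  \<comment> \<open>\<open>k\<close> is the position of the far end of the chord; its near end sits
    at position 0.\<close>
  obtain k where k: "k < n" "us ! k = head G a"
    using a(3) p'(2) by (metis image_set in_set_conv_nth n(2) us_def)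
  have arc: "head G (p' ! i) = us ! (Suc i mod n)" "tail G (p' ! i) = us ! i" if "i < n" for i
  proof -
    have "map (head G) p' ! i = rotate1 us ! i" using us(2) by simp
    then show "head G (p' ! i) = us ! (Suc i mod n)"
      using that n(2) by (simp add: nth_rotate1 n_def)
    show "tail G (p' ! i) = us ! i"
      using that by (simp add: us_def n_def)
  qed
  have not_edge: "{us ! i, us ! (Suc i mod n)} \<noteq> {tail G a, head G a}" if "i < n" for i
  proof
    assume "{us ! i, us ! (Suc i mod n)} = {tail G a, head G a}"
    then have "endpoints G (p' ! i) = endpoints G a"
      using arc[OF that] by (simp add: endpoints_def)
    moreover have "p' ! i \<in> set p" using that p'(2) by (metis n_def nth_mem)
    ultimately show False using chord by (metis imageI)
  qed
  \<comment> \<open>Position 0 would make the chord a loop; positions 1 and \<open>n - 1\<close>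
    would make it an edge of the cycle.\<close>
  have "k \<noteq> 0" using us0 k(2) no_loops[OF a(1)] by metis
  moreover have "k \<noteq> 1" using not_edge[of 0] us0 k n by auto
  moreover have "Suc k \<noteq> n"
    using not_edge[of k] us0 k by (auto simp: insert_commute)
  ultimately have k': "2 \<le> k" "k + 2 \<le> n" using k(1) by auto
  show thesis
  proof (cases "even k")
    case True
    \<comment> \<open>The chord followed by the arcs from position \<open>k\<close> back to the
      start: \<open>n - k + 1\<close> arcs, an even number since \<open>n\<close> is odd.\<close>
    have "map (head G) (drop k p') = drop (Suc k) us @ [tail G a]"
      using heads k' n by (simp add: drop_map[symmetric] drop_Suc)
    moreover have "map (tail G) (drop k p') = head G a # drop (Suc k) us"
      using k n Cons_nth_drop_Suc[of k us] by (simp add: us_def drop_map)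
    moreover have "distinct (map (tail G) (a # drop k p'))"
    proof -
      have "set (take k us) \<inter> set (drop k us) = {}"
        using us(1) by (simp add: set_take_disj_set_drop_if_distinct)
      moreover have "hd us \<in> set (take k us)"
        using k' \<open>us \<noteq> []\<close> by (cases us; cases k) auto
      ultimately have "tail G a \<notin> set (drop k us)" using hd by auto
      then show ?thesis using us(1) by (simp add: us_def drop_map[symmetric] del: set_map)
    qed
    ultimately have "undirected_cycle G (a # drop k p')"
      using us k' a(1) n(2) set_drop_subset[of k p']
      unfolding undirected_cycle_iff by (auto simp: n_def)
    moreover have "even (length (a # drop k p'))"
      using True n(3) k(1) by (simp add: n_def)
    ultimately show thesis by (rule that)
  next
    case False
    \<comment> \<open>The first \<open>k\<close> arcs, closed up by the reversed chord
      \<open>b\<close>, give \<open>k + 1\<close> arcs.\<close>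
    obtain b where b: "b \<in> arcs G" "tail G b = head G a" "head G b = tail G a"
      using sym_arcs a(1) unfolding symmetric_conv by metis
    have "map (head G) (take k p') = take k (tl us)"
      using heads k' n by (simp add: take_map[symmetric])
    moreover have "map (tail G) (take k p' @ [b]) = take (Suc k) us"
      using k n b(2) by (simp add: us_def take_Suc_conv_app_nth take_map)
    moreover have "take (Suc k) us = tail G a # take k (tl us)"
      using hd \<open>us \<noteq> []\<close> by (cases us) auto
    moreover have "distinct (take (Suc k) us)" using us(1) by simp
    ultimately have "undirected_cycle G (take k p' @ [b])"
      using us k' b n(2) set_take_subset[of k p']
      unfolding undirected_cycle_iff by (auto simp: n_def)
    moreover have "even (length (take k p' @ [b]))"
      using False k(1) by (simp add: n_def)
    ultimately show thesis by (rule that)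
  qed
qed

section \<open>Matchings\<close>

text \<open>Match the first vertex with the second, the third with the fourth, and so on.\<close>

lemma matching_of_even_path:
  assumes "distinct us" "even (length us)" "successively (\<lambda>u v. {u, v} \<in> edges G) us"
  shows "\<exists>N. matching G N \<and> \<Union>N = set us"
  using assms
proof (induction us rule: induct_list012)
  case 1
  then show ?case by (auto simp: matching_def intro: exI[of _ "{}"])
next
  case (2 u)
  then show ?case by simp
next
  case (3 u v us)
  then obtain N where N: "matching G N" "\<Union>N = set us"
    by (auto simp: successively_Cons)
  have "matching G (insert {u, v} N)"
    using N 3 unfolding matching_def pairwise_insert by (auto simp: disjnt_def)
  then show ?case
    using N(2) by (auto intro!: exI[of _ "insert {u, v} N"])
qed

lemma matching_disjointD:
  "matching G M \<Longrightarrow> e \<in> M \<Longrightarrow> f \<in> M \<Longrightarrow> x \<in> e \<Longrightarrow> x \<in> f \<Longrightarrow> e = f"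
  unfolding matching_def pairwise_def disjnt_def by blast

lemma (in wf_digraph) Union_matching_subset: "matching G M \<Longrightarrow> \<Union>M \<subseteq> verts G"
  by (auto simp: matching_def edges_def endpoints_def dest!: subsetD)

lemma (in fin_digraph) finite_edges: "finite (edges G)"
  by (simp add: edges_def)

lemma (in fin_digraph) finite_matching: "matching G M \<Longrightarrow> finite M"
  using finite_edges unfolding matching_def by (blast intro: finite_subset)

lemma (in fin_digraph) maximum_matching_exists: "\<exists>M. maximum_matching G M"
proof -
  have "matching G {}" by (simp add: matching_def)
  then show ?thesis
    using ex_has_greatest_nat[of "matching G" "{}" card "card (edges G) + 1"]
      card_mono[OF finite_edges] unfolding maximum_matching_def
    by (metis (no_types, lifting) Suc_eq_plus1 le_imp_less_Suc matching_def)
qed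

text \<open>
  Among the maximum matchings choose one sharing as many edges as possible with \<^term>\<open>N\<close>. If it
  misses an end of an edge of \<^term>\<open>N\<close>, exchanging that edge for the one at the other end
  increases the overlap.
\<close>

lemma (in fin_digraph) maximum_matching_covering:
  assumes N: "matching G N"
  obtains M where "maximum_matching G M" "\<Union>N \<subseteq> \<Union>M"
proof -
  obtain M where M: "maximum_matching G M"
    and best: "\<And>M'. maximum_matching G M' \<Longrightarrow> card (M' \<inter> N) \<le> card (M \<inter> N)"
    using maximum_matching_exists
      ex_has_greatest_nat[of "maximum_matching G" _ "\<lambda>M. card (M \<inter> N)" "card N + 1"]
      card_mono[OF finite_matching[OF N]]
    by (metis Int_lower2 Suc_eq_plus1 le_imp_less_Suc)
  have mM: "matching G M" and finM: "finite M"
    using M finite_matching by (auto simp: maximum_matching_def)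
  have "v \<in> \<Union>M" if v: "v \<in> e" "e \<in> N" for v e
  proof (rule ccontr)
    assume v': "v \<notin> \<Union>M"
    then have eM: "e \<notin> M" using v by auto
    obtain w where e: "e = {v, w}"
      using v N by (auto simp: matching_def edges_def endpoints_def)
    show False
    proof (cases "w \<in> \<Union>M")
      case False
      \<comment> \<open>Neither end of \<open>e\<close> is covered, so adding \<open>e\<close> would
        enlarge a maximum matching.\<close>
      then have "matching G (insert e M)"
        using mM N v v' unfolding matching_def pairwise_insert by (auto simp: disjnt_def e)
      then have "card (insert e M) \<le> card M"
        using M by (simp add: maximum_matching_def)
      then show False using eM finM by simp
    next
      case True
      then obtain f where f: "f \<in> M" "w \<in> f" by auto
      \<comment> \<open>\<open>e\<close> and \<open>f\<close> share \<open>w\<close>, so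
        \<open>N\<close> cannot contain both; the exchange gives up no edge of
        \<open>N\<close>.\<close>
      then have fN: "f \<notin> N" using matching_disjointD[OF N v(2), of f w] eM e by auto
      let ?M = "insert e (M - {f})"
      have "w \<notin> g" "v \<notin> g" if "g \<in> M - {f}" for g
        using that v' matching_disjointD[OF mM f(1) _ f(2)] by blast+
      then have "disjnt e g" "disjnt g e" if "g \<in> M - {f}" for g
        using that by (auto simp: disjnt_def e)
      moreover have "pairwise disjnt (M - {f})"
        using mM unfolding matching_def by (blast intro: pairwise_subset)
      ultimately have "matching G ?M"
        using mM N v(2) unfolding matching_def pairwise_insert by blast
      moreover have "card ?M = card M"
        using eM finM f card_Suc_Diff1[OF finM f(1)] by simp
      ultimately have "maximum_matching G ?M"
        using M by (simp add: maximum_matching_def)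
      then have "card (?M \<inter> N) \<le> card (M \<inter> N)" by (rule best)
      moreover have "?M \<inter> N = insert e (M \<inter> N)" using v fN by auto
      ultimately show False using eM finM by simp
    qed
  qed
  then show thesis using that M by blast
qed

text \<open>By \<open>closed\<close>, the edges of \<open>M\<close> inside \<open>S\<close>
  partition \<open>S\<close>, and without loops each has exactly two elements.\<close>

lemma (in loopfree_digraph) even_card_matched:
  assumes M: "matching G M" and S: "finite S" "S \<subseteq> \<Union>M"
    and closed: "\<And>e. e \<in> M \<Longrightarrow> e \<inter> S \<noteq> {} \<Longrightarrow> e \<subseteq> S"
  shows "even (card S)"
proof -
  let ?C = "{e \<in> M. e \<subseteq> S}"
  have eq: "\<Union>?C = S"
  proof
    show "S \<subseteq> \<Union>?C"
    proof
      fix x assume "x \<in> S"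
      then obtain e where "e \<in> M" "x \<in> e" using S(2) by auto
      then show "x \<in> \<Union>?C" using closed[of e] \<open>x \<in> S\<close> by auto
    qed
  qed auto
  have "2 dvd card (\<Union>?C)"
  proof (rule dvd_partition)
    show "finite (\<Union>?C)" using eq S(1) by simp
    have "card c = 2" if "c \<in> edges G" for c
      using that no_loops by (auto simp: edges_def endpoints_def card_insert_if)
    then show "\<forall>c\<in>?C. 2 dvd card c"
      using M by (auto simp: matching_def)
    show "\<forall>c1\<in>?C. \<forall>c2\<in>?C. c1 \<noteq> c2 \<longrightarrow> c1 \<inter> c2 = {}"
      using M by (auto simp: matching_def pairwise_def disjnt_def)
  qed
  then show ?thesis by (simp add: eq)
qed

section \<open>Components\<close>

text \<open>Applied to the vertex set of a cycle: either the cycle spans the graph or some arc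
  leaves it.\<close>

lemma (in wf_digraph) strongly_connected_closed_subset:
  assumes "strongly_connected G" "x \<in> verts G" "x \<in> S"
    and closed: "\<And>a. a \<in> arcs G \<Longrightarrow> tail G a \<in> S \<Longrightarrow> head G a \<in> S"
  shows "verts G \<subseteq> S"
proof
  fix y assume "y \<in> verts G"
  then have "x \<rightarrow>\<^sup>* y" using assms by auto
  then show "y \<in> S"
    by (induct rule: reachable_induct) (use assms in auto)
qed

text \<open>Adding arcs between existing vertices preserves connectedness, so maximality forces
  \<open>H\<close> to be induced, and induced subgraphs inherit symmetry.\<close>

lemma (in graph) component_graph:
  assumes "component G H"
  shows "subgraph H G" "Digraph.graph H" "connected H"
proof -
  have max: "max_subgraph connected H" using assms by (simp add: component_def)
  then show "subgraph H G" "connected H" by (simp_all add: max_subgraph_def)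
  have "arc_mono (connected :: ('a, 'b) pre_digraph \<Rightarrow> bool)"
    unfolding arc_mono_def
    by (metis spanning_def subgraphE wf_digraph.connected_spanning_imp_connected)
  then have ind: "induced_subgraph H G"
    using max by (rule induced_subgraphI_arc_mono[rotated])
  interpret H: digraph H using \<open>subgraph H G\<close> by (rule digraph_subgraph)
  show "Digraph.graph H"
    using induced_graph_imp_symmetric[OF sym_arcs ind] by (rule H.graphI)
qed

text \<open>Symmetry makes directed and undirected reachability agree, so a connected subgraph
  containing \<open>u\<close> cannot leave this set.\<close>

lemma (in graph) component_reachable:
  assumes "u \<in> verts G"
  shows "component G (G \<restriction> {v. u \<rightarrow>\<^sup>* v})"
proof -
  let ?H = "G \<restriction> {v. u \<rightarrow>\<^sup>* v}"
  have sub: "subgraph ?H G"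
    by (rule subgraph_induce_subgraphI) (auto dest: reachable_in_verts)
  then interpret H: wf_digraph ?H by auto
  have "strongly_connected ?H"
    using induce_reachable_is_in_sccs[OF assms] by (auto simp: sccs_def)
  then have "connected ?H"
    unfolding connected_def strongly_connected_def
    using H.reachable_mk_symmetricI by simp
  moreover have "\<not> connected H'" if ne: "?H \<noteq> H'" and H': "subgraph ?H H'" "subgraph H' G" for H'
  proof
    assume "connected H'"
    have "verts H' \<subseteq> {v. u \<rightarrow>\<^sup>* v}"
    proof
      fix v assume v: "v \<in> verts H'"
      have "u \<in> verts H'" using H'(1) assms by (auto simp: subgraph_def)
      then have "u \<rightarrow>\<^sup>*\<^bsub>mk_symmetric H'\<^esub> v"
        using \<open>connected H'\<close> v by (auto simp: connected_def)
      then have "u \<rightarrow>\<^sup>*\<^bsub>mk_symmetric G\<^esub> v"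
        by (rule pre_digraph.reachable_mono) (rule subgraph_mk_symmetric[OF H'(2)])
      then show "v \<in> {v. u \<rightarrow>\<^sup>* v}"
        using reachable_mk_symmetric_eq[OF sym_arcs] by simp
    qed
    moreover have "arcs H' \<subseteq> {e \<in> arcs G. tail G e \<in> verts H' \<and> head G e \<in> verts H'}"
      using H'(2) by (auto simp: subgraph_def compatible_def wf_digraph_def)
    moreover have "verts ?H \<subseteq> verts H'" "arcs ?H \<subseteq> arcs H'" "tail ?H = tail H'" "head ?H = head H'"
      using H'(1) by (auto simp: subgraph_def compatible_def)
    ultimately have "?H = H'"
      by (intro pre_digraph.equality) auto
    then show False using ne by simp
  qed
  ultimately show ?thesis
    using sub unfolding component_def by (intro max_subgraphI) auto
qed

text \<open>\<open>N\<close> may be any matching: \<open>maximum_matching_covering\<close> later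
  supplies a maximum one covering the same vertices.\<close>

lemma (in graph) matched_cycle_exists:
  assumes "connected G" "undirected_cycle G p" "\<not> odd_cycle_graph G"
  shows "\<exists>N q. matching G N \<and> undirected_cycle G q \<and> tail G ` set q \<subseteq> \<Union>N"
proof -
  have even: ?thesis if q: "undirected_cycle G q" "even (length q)" for q
  proof -
    have "distinct (map (tail G) q)" "even (length (map (tail G) q))"
      using q by (auto simp: undirected_cycle_iff)
    then obtain N where "matching G N" "\<Union>N = set (map (tail G) q)"
      using matching_of_even_path undirected_cycle_successively[OF q(1)] by blast
    then show ?thesis using q(1) by (intro exI[of _ N] exI[of _ q]) simp
  qed
  have sc: "strongly_connected G"
    by (rule symmetric_connected_imp_strongly_connected) (use assms in auto)
  have pv: "p \<noteq> []" "set p \<subseteq> arcs G" "tail G ` set p \<subseteq> verts G"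
    using assms(2) by (auto simp: undirected_cycle_iff)
  show ?thesis
  proof (cases "even (length p)")
    case True
    then show ?thesis using assms(2) even by blast
  next
    case odd: False
    show ?thesis
    proof (cases "verts G \<subseteq> tail G ` set p")
      case True
      then have "verts G = tail G ` set p" using pv by auto
      \<comment> \<open>The odd cycle spans all vertices, so only an additional edge, a chord, can
        prevent \<open>G\<close> from being an odd cycle.\<close>
      then have "edges G \<noteq> endpoints G ` set p"
        using assms odd by (auto simp: odd_cycle_graph_def)
      then obtain a where "a \<in> arcs G" "endpoints G a \<notin> endpoints G ` set p"
        using pv(2) by (auto simp: edges_def)
      then show ?thesis
        using even_cycle_of_chord[OF assms(2) odd] True even
        by (metis head_in_verts subsetD tail_in_verts)
    next
      case False
      have "tail G (hd p) \<in> tail G ` set p" using pv(1) by simp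
      moreover from this have "tail G (hd p) \<in> verts G" using pv(3) by (rule rev_subsetD)
      ultimately obtain a
        where a: "a \<in> arcs G" "tail G a \<in> tail G ` set p" "head G a \<notin> tail G ` set p"
        using strongly_connected_closed_subset[OF sc, of "tail G (hd p)" "tail G ` set p"] False
        by metis
      obtain q where q: "undirected_cycle G q" "set q = set p" "length q = length p"
        "tail G (hd q) = tail G a"
        using undirected_cycle_rotate_to[OF assms(2) a(2)] by metis
      have "q \<noteq> []" using q(3) pv(1) by auto
      \<comment> \<open>This path starts at the outside neighbour and then runs once round the
        cycle, omitting its closing edge; the extra vertex makes the count even.\<close>
      let ?us = "head G a # map (tail G) q"
      have "endpoints G a \<in> edges G" using a(1) by (simp add: edges_def)
      then have "successively (\<lambda>u v. {u, v} \<in> edges G) ?us"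
        using undirected_cycle_successively[OF q(1)] q(4) \<open>q \<noteq> []\<close>
        by (simp add: successively_Cons hd_map endpoints_def insert_commute)
      moreover have "distinct ?us"
        using q(1,2) a(3) by (auto simp: undirected_cycle_iff)
      moreover have "even (length ?us)" using odd q(3) by simp
      ultimately obtain N where "matching G N" "\<Union>N = set ?us"
        using matching_of_even_path by blast
      then show ?thesis using q(1) by (intro exI[of _ N] exI[of _ q]) auto
    qed
  qed
qed

text \<open>Vertices of a cycle graph have at most two neighbours, and \<open>q\<close> already uses
  two at each of its vertices. Hence no arc leaves \<open>q\<close>, and connectedness does the
  rest.\<close>

lemma (in graph) cycle_spans_odd_cycle_graph:
  assumes "connected G" "odd_cycle_graph G" "undirected_cycle G q"
  shows "verts G \<subseteq> tail G ` set q"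
proof -
  obtain p where p: "undirected_cycle G p" "edges G = endpoints G ` set p"
    using assms(2) by (auto simp: odd_cycle_graph_def)
  have inj: "inj_on (tail G) (set p)" "inj_on (head G) (set p)"
    using p(1) unfolding undirected_cycle_iff
    by (metis distinct_map distinct1_rotate)+
  have sc: "strongly_connected G"
    by (rule symmetric_connected_imp_strongly_connected) (use assms in auto)
  have qv: "q \<noteq> []" "set q \<subseteq> arcs G" "head G ` set q = tail G ` set q"
    using assms(3) by (auto simp: undirected_cycle_iff simp flip: set_map)
  \<comment> \<open>Orients the edges along \<open>p\<close>. Injectivity of tails and heads on
    \<open>p\<close> leaves each vertex at most one successor and one predecessor.\<close>
  define succ where "succ x y \<longleftrightarrow> (\<exists>e\<in>set p. tail G e = x \<and> head G e = y)" for x y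
  have succ: "succ x y \<or> succ y x" if "{x, y} \<in> edges G" for x y
    using that p(2) unfolding succ_def by (auto simp: endpoints_def doubleton_eq_iff)
  have succ_unique: "y = z" if "succ x y \<and> succ x z \<or> succ y x \<and> succ z x" for x y z
    using that inj unfolding succ_def by (auto dest: inj_onD)
  have closed: "head G a \<in> tail G ` set q" if a: "a \<in> arcs G" "tail G a \<in> tail G ` set q" for a
  proof -
    define x where "x = tail G a"
    obtain e f where ef: "e \<in> set q" "f \<in> set q" "tail G e = x" "head G f = x" "head G e \<noteq> tail G f"
      using undirected_cycle_neighbours[OF assms(3) a(2)] x_def by metis
    have "endpoints G a \<in> edges G" "endpoints G e \<in> edges G" "endpoints G f \<in> edges G"
      using a(1) ef qv(2) by (auto simp: edges_def)
    then have "{x, head G a} \<in> edges G" "{x, head G e} \<in> edges G" "{x, tail G f} \<in> edges G"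
      using ef by (simp_all add: endpoints_def x_def insert_commute)
    \<comment> \<open>The two distinct neighbours on \<open>q\<close> are the successor and the
      predecessor of \<open>x\<close> in some order, so no third neighbour is possible.\<close>
    then have "head G a \<in> {head G e, tail G f}"
      using succ succ_unique ef(5) by (metis insert_iff)
    then show ?thesis using ef qv(3) by auto
  qed
  have "tail G (hd q) \<in> verts G" "tail G (hd q) \<in> tail G ` set q"
    using qv(2) hd_in_set[OF qv(1)] by (auto simp del: hd_in_set)
  then show ?thesis
    using strongly_connected_closed_subset[OF sc] closed by metis
qed

theorem theorem5:
  fixes G :: "('a, 'b) pre_digraph"
  assumes "Digraph.graph G"
  shows "(\<forall>M. maximum_matching G M \<longrightarrow> acyclic_matching G M) \<longleftrightarrow>
    (\<forall>H. component G H \<longrightarrow> undirected_tree H \<or> odd_cycle_graph H)"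
proof -
  interpret G: Digraph.graph G by fact
  show ?thesis
  proof (intro iffI allI impI)
    fix H
    assume acyclic: "\<forall>M. maximum_matching G M \<longrightarrow> acyclic_matching G M" and comp: "component G H"
    note H = G.component_graph[OF comp]
    interpret H: Digraph.graph H by fact
    show "undirected_tree H \<or> odd_cycle_graph H"
    proof (rule ccontr)
      assume "\<not> ?thesis"
      then obtain p where "undirected_cycle H p" "\<not> odd_cycle_graph H"
        using H(3) by (auto simp: undirected_tree_def undirected_forest_def)
      then obtain N q where N: "matching H N" and q: "undirected_cycle H q" "tail H ` set q \<subseteq> \<Union>N"
        using H.matched_cycle_exists[OF H(3)] by metis
      have tl: "tail H = tail G" "head H = head G" "arcs H \<subseteq> arcs G"
        using H(1) by (auto simp: subgraph_def compatible_def)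
      then have "endpoints H = endpoints G" by (simp add: endpoints_def fun_eq_iff)
      then have "matching G N"
        using N image_mono[OF tl(3)] unfolding matching_def edges_def by (metis subset_trans)
      then obtain M where M: "maximum_matching G M" "\<Union>N \<subseteq> \<Union>M"
        by (rule G.maximum_matching_covering)
      \<comment> \<open>\<open>M\<close> covers every vertex covered by \<open>N\<close>, in
        particular all of \<open>q\<close>, so the cycle survives in the subgraph induced by
        \<open>M\<close>.\<close>
      have "undirected_cycle (G \<restriction> \<Union>M) q"
        using G.undirected_cycle_induce G.undirected_cycle_subgraph[OF H(1) q(1)] q(2) M(2) tl(1)
        by (metis subset_trans)
      then show False
        using acyclic M(1) by (auto simp: acyclic_matching_def undirected_forest_def)
    qed
  next
    fix M
    assume comps: "\<forall>H. component G H \<longrightarrow> undirected_tree H \<or> odd_cycle_graph H"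
      and "maximum_matching G M"
    then have M: "matching G M" by (simp add: maximum_matching_def)
    have "\<not> undirected_cycle (G \<restriction> \<Union>M) q" for q
    proof
      assume "undirected_cycle (G \<restriction> \<Union>M) q"
      interpret GM: wf_digraph "G \<restriction> \<Union>M" ..
      have qM: "tail G ` set q \<subseteq> \<Union>M"
        using \<open>undirected_cycle (G \<restriction> \<Union>M) q\<close> by (auto simp: GM.undirected_cycle_iff)
      have q: "undirected_cycle G q"
        using \<open>undirected_cycle (G \<restriction> \<Union>M) q\<close>
          G.subgraph_induce_subgraphI[OF G.Union_matching_subset[OF M]]
        by (rule G.undirected_cycle_subgraph[rotated])
      then obtain u where "G.awalk u q u"
        by (auto simp: undirected_cycle_def G.cycle_def)
      \<comment> \<open>The vertex set of the component that contains \<open>q\<close>.\<close>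
      define S where "S = {v. u \<rightarrow>\<^sup>*\<^bsub>G\<^esub> v}"
      have "u \<in> verts G" using \<open>G.awalk u q u\<close> by auto
      then have comp: "component G (G \<restriction> S)"
        unfolding S_def by (rule G.component_reachable)
      have "tail G ` set q \<subseteq> S"
        using G.awalk_verts_reachable_from[OF \<open>G.awalk u q u\<close>] G.awalk_verts_arc1
        by (auto simp: S_def)
      then have qS: "undirected_cycle (G \<restriction> S) q"
        by (rule G.undirected_cycle_induce[OF q])
      \<comment> \<open>The cycle \<open>q\<close> rules out the alternative that this component is
        a tree.\<close>
      then have odd: "odd_cycle_graph (G \<restriction> S)"
        using comps comp by (auto simp: undirected_tree_def undirected_forest_def)
      interpret S: Digraph.graph "G \<restriction> S" using G.component_graph(2)[OF comp] .
      have "S \<subseteq> tail G ` set q"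
        using S.cycle_spans_odd_cycle_graph[OF G.component_graph(3)[OF comp] odd qS] by simp
      then have "S \<subseteq> \<Union>M" using qM by blast
      \<comment> \<open>No edge of \<open>G\<close> joins \<open>S\<close> to a vertex outside it,
        since both orientations of the edge are arcs.\<close>
      moreover have "e \<subseteq> S" if e: "e \<in> M" "e \<inter> S \<noteq> {}" for e
      proof -
        obtain a where a: "a \<in> arcs G" "e = {tail G a, head G a}"
          using M e by (auto simp: matching_def edges_def endpoints_def)
        then have "tail G a \<rightarrow>\<^bsub>G\<^esub> head G a" "head G a \<rightarrow>\<^bsub>G\<^esub> tail G a"
          by (auto intro: G.in_arcs_imp_in_arcs_ends G.graph_symmetric)
        then show ?thesis
          using e a(2) by (auto simp: S_def intro: G.reachable_adj_trans)
      qed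
      ultimately have "even (card S)"
        using G.even_card_matched[OF M] S.finite_verts by simp
      \<comment> \<open>The tails along the spanning odd cycle are distinct, so \<open>S\<close> has
        as many elements as that cycle has arcs.\<close>
      moreover have "odd (card S)"
      proof -
        obtain p where p: "undirected_cycle (G \<restriction> S) p" "odd (length p)" "S = tail G ` set p"
          using odd by (auto simp: odd_cycle_graph_def)
        then have "distinct (map (tail G) p)" unfolding S.undirected_cycle_iff by simp
        then have "card (set (map (tail G) p)) = length p"
          by (simp only: distinct_card length_map)
        then show ?thesis using p by simp
      qed
      ultimately show False by simp
    qed
    then show "acyclic_matching G M"
      using M by (simp add: acyclic_matching_def undirected_forest_def)
  qed
qed

end
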